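(* Let $\mathcal{H}=\{h_i\}_{i=1}^N$ be a set of barrier function candidates for the parameterized zero dynamics $\dot{\bm z}=\bm\omega(\bm 0,\bm z;\bm\theta)$, $\bm z\in\mathcal{Z}$, $\bm\theta\in\bm\Theta$, let $\overline{\mathcal{S}}_i\subset\mathcal{Z}$ ($i=1,\dots,N$) be the corresponding compact regions at risk, and let $\alpha\in\mathcal{K}_{\infty,e}$. Define the Barrier Loss $\mathscr{L}:\bm\Theta\to\mathbb{R}_{\ge 0}$ by $$\mathscr{L}(\bm\theta)=\sum_{i=1}^N\int_{\overline{\mathcal{S}}_i}\max\{0,\,-\dot h_i(\bm z;\bm\theta)-\alpha(h_i(\bm z;\bm\theta))\}\,d\bm z .$$ Then for a parameter $\bm\theta^*\in\bm\Theta$, the zero dynamics with parameter $\bm\theta^*$ is safe in all its regions at risk, i.e. $$\dot h_i(\bm z;\bm\theta^* )\ \ge\ -\alpha(h_i(\bm z;\bm\theta^* ))\qquad\text{for all } i\in\{1,\dots,N\}\text{ and all }\bm z\in\overline{\mathcal{S}}_i,$$ if and only if $\mathscr{L}(\bm\theta^* )=0$.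
   Context: $\mathcal{Z}\subseteq\mathbb{R}^2$ is the zero dynamics space (coordinates of the unactuated part of the system when the output error coordinates $\bm\eta$ vanish), and $\bm\Theta$ is a parameter space (the parameters of the policy). For each $\bm\theta\in\bm\Theta$ the zero dynamics is $\dot{\bm z}=\bm\omega(\bm 0,\bm z;\bm\theta)$ with $\bm z\mapsto\bm\omega(\bm 0,\bm z;\bm\theta)$ locally Lipschitz. A barrier function candidate is a function $h_i(\cdot\,;\bm\theta):\mathcal{Z}\to\mathbb{R}$, possibly depending on $\bm\theta$, continuously differentiable in $\bm z$. Its derivative along the zero dynamics is $\dot h_i(\bm z;\bm\theta)=\frac{\partial h_i}{\partial\bm z}(\bm z;\bm\theta)\,\bm\omega(\bm 0,\bm z;\bm\theta)$. To each $h_i$ is associated a region at risk $\overline{\mathcal{S}}_i\subseteq\mathcal{Z}$, the compact set on which the barrier condition is enforced. Integrals are with respect to Lebesgue measure $d\bm z$. A function $\alpha:\mathbb{R}\to\mathbb{R}$ belongs to $\mathcal{K}_{\infty,e}$ (extended class $\mathcal{K}_\infty$) if it is continuous, strictly increasing, $\alpha(0)=0$, $\lim_{a\to\infty}\alpha(a)=\infty$ and $\lim_{a\to-\infty}\alpha(a)=-\infty$. A parameter $\bm\theta$ is said to render the region at risk $\overline{\mathcal{S}}_i$ safe (under the barrier definition) if it belongs to $\bm\Theta_i=\{\bm\theta\in\bm\Theta:\ \dot h_i(\bm z;\bm\theta)\ge-\alpha(h_i(\bm z;\bm\theta))\ \text{for all }\bm z\in\overline{\mathcal{S}}_i\}$.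 The zero dynamics with parameter $\bm\theta$ is safe in all its regions at risk if $\bm\theta\in\bigcap_{i=1}^N\bm\Theta_i$.
   Formalization: Each compact region at risk is additionally assumed to have no nonempty relatively open part of Lebesgue measure zero (true for closures of open sets); without this, e.g. for a single-point region, zero Barrier Loss does not imply safety. *)

theory Defs
  imports "HOL-Analysis.Analysis"
begin

definition extended_class_K_inf :: "(real \<Rightarrow> real) \<Rightarrow> bool" where
  "extended_class_K_inf \<alpha> \<longleftrightarrow>
     continuous_on UNIV \<alpha> \<and> strict_mono \<alpha> \<and> \<alpha> 0 = 0 \<and>
     filterlim \<alpha> at_top at_top \<and> filterlim \<alpha> at_bot at_bot"

(* Continuous differentiability on the state space Z, with the derivative Dh kept as a witness.
   Z is an arbitrary set, so the derivative is taken within Z; it is the usual one at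
   interior points of Z. *)
definition barrier_candidate ::
  "(real^2) set \<Rightarrow> (real^2 \<Rightarrow> real) \<Rightarrow> (real^2 \<Rightarrow> (real^2) \<Rightarrow>\<^sub>L real) \<Rightarrow> bool" where
  "barrier_candidate Z h Dh \<longleftrightarrow>
     (\<forall>z\<in>Z. (h has_derivative blinfun_apply (Dh z)) (at z within Z)) \<and> continuous_on Z Dh"

definition derivative_along ::
  "(real^2 \<Rightarrow> (real^2) \<Rightarrow>\<^sub>L real) \<Rightarrow> (real^2 \<Rightarrow> real^2) \<Rightarrow> real^2 \<Rightarrow> real" where
  "derivative_along Dh f z = blinfun_apply (Dh z) (f z)"

definition zero_dynamics ::
  "('e::euclidean_space \<Rightarrow> real^2 \<Rightarrow> 'p \<Rightarrow> real^2) \<Rightarrow> 'p \<Rightarrow> real^2 \<Rightarrow> real^2" where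
  "zero_dynamics \<omega> \<theta> z = \<omega> 0 z \<theta>"

(* A region must not have relatively open pieces of measure zero: on such a piece, e.g. an
   isolated point or a hair, the barrier condition can fail without being seen by any integral.
   Closures of open sets qualify, see solid_region_closure_open. *)
definition solid_region :: "'a::euclidean_space set \<Rightarrow> bool" where
  "solid_region A \<longleftrightarrow> (\<forall>U. open U \<longrightarrow> A \<inter> U \<noteq> {} \<longrightarrow> \<not> negligible (A \<inter> U))"

lemma solid_region_closure_open:
  fixes G :: "'a::euclidean_space set"
  assumes "open G"
  shows "solid_region (closure G)"
  unfolding solid_region_def
proof (intro allI impI notI)
  fix U :: "'a set"
  assume U: "open U" "closure G \<inter> U \<noteq> {}" "negligible (closure G \<inter> U)"
  have "G \<inter> U \<noteq> {}"
    using U(1,2) open_Int_closure_eq_empty[of U G] by (auto simp: Int_commute)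
  moreover have "negligible (G \<inter> U)"
    using U(3) closure_subset[of G] by (auto intro: negligible_subset)
  ultimately show False
    using open_not_negligible[of "G \<inter> U"] assms U(1) by auto
qed

definition safe_parameters ::
  "'p set \<Rightarrow> (real^2 \<Rightarrow> 'p \<Rightarrow> real) \<Rightarrow> ('p \<Rightarrow> real^2 \<Rightarrow> (real^2) \<Rightarrow>\<^sub>L real) \<Rightarrow>
   ('p \<Rightarrow> real^2 \<Rightarrow> real^2) \<Rightarrow> (real \<Rightarrow> real) \<Rightarrow> (real^2) set \<Rightarrow> 'p set" where
  "safe_parameters \<Theta> h Dh f \<alpha> S =
     {\<theta>\<in>\<Theta>. \<forall>z\<in>S. derivative_along (Dh \<theta>) (f \<theta>) z \<ge> - \<alpha> (h z \<theta>)}"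

definition barrier_loss ::
  "nat \<Rightarrow> (nat \<Rightarrow> real^2 \<Rightarrow> 'p \<Rightarrow> real) \<Rightarrow> (nat \<Rightarrow> 'p \<Rightarrow> real^2 \<Rightarrow> (real^2) \<Rightarrow>\<^sub>L real) \<Rightarrow>
   ('p \<Rightarrow> real^2 \<Rightarrow> real^2) \<Rightarrow> (real \<Rightarrow> real) \<Rightarrow> (nat \<Rightarrow> (real^2) set) \<Rightarrow> 'p \<Rightarrow> real" where
  "barrier_loss N h Dh f \<alpha> S \<theta> =
     (\<Sum>i=1..N. LINT z:S i|lebesgue.
        max 0 (- derivative_along (Dh i \<theta>) (f \<theta>) z - \<alpha> (h i z \<theta>)))"

lemma barrier_loss_nonneg: "barrier_loss N h Dh f \<alpha> S \<theta> \<ge> 0"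
  unfolding barrier_loss_def set_lebesgue_integral_def
  by (intro sum_nonneg Bochner_Integration.integral_nonneg) auto

end

theory Submission
  imports Defs
begin

text \<open>The loss is a finite sum of integrals of nonnegative violations, so it vanishes iff each
  integral does. A zero integral makes a nonnegative violation vanish almost everywhere; the point
  is to get every point of the region. If a continuous violation were positive somewhere, it would
  be positive on a relatively open piece, which is not negligible in a solid region. This is
  \<open>set_lebesgue_integral_eq_0_iff_on_solid_region\<close>;
  \<open>continuous_on_barrier_violation\<close> supplies the continuity. A violation of zero is the
  barrier inequality.\<close>

lemma set_lebesgue_integral_eq_0_iff_on_solid_region:
  fixes g :: "'a::euclidean_space \<Rightarrow> real"
  assumes "compact S" "solid_region S" and cont: "continuous_on S g"
    and nonneg: "\<And>z. z \<in> S \<Longrightarrow> g z \<ge> 0"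
  shows "(LINT z:S|lebesgue. g z) = 0 \<longleftrightarrow> (\<forall>z\<in>S. g z = 0)"
proof
  let ?G = "\<lambda>z. indicator S z *\<^sub>R g z"
  assume "(LINT z:S|lebesgue. g z) = 0"
  \<comment> \<open>The integral of a non-integrable function is 0 by default, so its vanishing says
    something only together with integrability. Continuity on a compact set gives it for the Borel
    measure, and it passes to the completion.\<close>
  moreover have "integrable lebesgue ?G"
    using borel_integrable_compact[OF assms(1) cont]
    by (intro integrable_completion[THEN iffD2]) auto
  ultimately have "AE z in lebesgue. ?G z = 0"
    using nonneg integral_nonneg_eq_0_iff_AE[of lebesgue ?G]
    by (simp add: set_lebesgue_integral_def indicator_def)
  then have null: "negligible {z. ?G z \<noteq> 0}"
    unfolding eventually_ae_filter
    by (auto simp: negligible_iff_null_sets intro: null_sets_completion_subset)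
  \<comment> \<open>Positivity of \<open>g\<close> is a relatively open condition on
    \<open>S\<close>, so it is cut out by an open set, as \<open>solid_region\<close>
    requires.\<close>
  obtain U where "open U" "U \<inter> S = g -` {0<..} \<inter> S"
    using cont by (meson continuous_on_open_invariant open_greaterThan)
  then have U: "open U" "S \<inter> U = {z \<in> S. g z > 0}"
    by auto
  have "S \<inter> U \<subseteq> {z. ?G z \<noteq> 0}"
    using U(2) by (auto simp: indicator_def)
  then have "S \<inter> U = {}"
    using null U(1) assms(2) negligible_subset unfolding solid_region_def by blast
  then show "\<forall>z\<in>S. g z = 0"
    using U(2) nonneg by (force simp: order.order_iff_strict)
next
  assume "\<forall>z\<in>S. g z = 0"
  then show "(LINT z:S|lebesgue. g z) = 0"
    unfolding set_lebesgue_integral_def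
    by (intro integral_eq_zero_AE AE_I2) (auto simp: indicator_def)
qed

text \<open>Differentiability within \<open>Z\<close> makes \<open>h\<close> continuous, and
  applying the continuous \<open>Dh\<close> to a continuous vector field is continuous; composition
  with \<alpha> and the maximum preserve this.\<close>

lemma continuous_on_barrier_violation:
  assumes "barrier_candidate Z h Dh" "continuous_on Z f" "extended_class_K_inf \<alpha>"
  shows "continuous_on Z (\<lambda>z. max 0 (- derivative_along Dh f z - \<alpha> (h z)))"
proof -
  have "continuous_on Z h"
    using assms(1) unfolding barrier_candidate_def
    by (meson continuous_on_eq_continuous_within has_derivative_continuous)
  moreover have "continuous_on UNIV \<alpha>"
    using assms(3) by (simp add: extended_class_K_inf_def)
  ultimately have "continuous_on Z (\<lambda>z. \<alpha> (h z))"
    by (auto intro: continuous_on_compose2)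
  moreover have "continuous_on Z (derivative_along Dh f)"
    using assms(1,2) unfolding barrier_candidate_def derivative_along_def
    by (auto intro!: continuous_intros)
  ultimately show ?thesis
    by (intro continuous_intros)
qed

theorem theorem4:
  fixes Z :: "(real^2) set"
    and \<Theta> :: "'p set"
    and \<omega> :: "'e::euclidean_space \<Rightarrow> real^2 \<Rightarrow> 'p \<Rightarrow> real^2"
    and N :: nat
    and h :: "nat \<Rightarrow> real^2 \<Rightarrow> 'p \<Rightarrow> real"
    and Dh :: "nat \<Rightarrow> 'p \<Rightarrow> real^2 \<Rightarrow> (real^2) \<Rightarrow>\<^sub>L real"
    and S :: "nat \<Rightarrow> (real^2) set"
    and \<alpha> :: "real \<Rightarrow> real"
    and \<theta>s :: 'p
  assumes "\<And>\<theta>. \<theta> \<in> \<Theta> \<Longrightarrow> local_lipschitz (UNIV :: real set) Z (\<lambda>t. zero_dynamics \<omega> \<theta>)"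
    and "\<And>i \<theta>. i \<in> {1..N} \<Longrightarrow> \<theta> \<in> \<Theta> \<Longrightarrow> barrier_candidate Z (\<lambda>z. h i z \<theta>) (Dh i \<theta>)"
    and "\<And>i. i \<in> {1..N} \<Longrightarrow> S i \<subseteq> Z"
    and "\<And>i. i \<in> {1..N} \<Longrightarrow> compact (S i)"
    and "\<And>i. i \<in> {1..N} \<Longrightarrow> solid_region (S i)"
    and "extended_class_K_inf \<alpha>"
    and "\<theta>s \<in> \<Theta>"
  shows "\<theta>s \<in> (\<Inter>i\<in>{1..N}. safe_parameters \<Theta> (h i) (Dh i) (zero_dynamics \<omega>) \<alpha> (S i))
     \<longleftrightarrow> barrier_loss N h Dh (zero_dynamics \<omega>) \<alpha> S \<theta>s = 0"
proof -
  define g where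
    "g i z = max 0 (- derivative_along (Dh i \<theta>s) (zero_dynamics \<omega> \<theta>s) z - \<alpha> (h i z \<theta>s))" for i z
  \<comment> \<open>The local Lipschitz condition enters as continuity of the vector field in the
    state.\<close>
  have "continuous_on Z (zero_dynamics \<omega> \<theta>s)"
    using local_lipschitz_continuous_on[OF assms(1)[OF assms(7)]] by simp
  then have cont: "continuous_on (S i) (g i)" if "i \<in> {1..N}" for i
    using continuous_on_barrier_violation[OF assms(2)[OF that assms(7)] _ assms(6)]
      assms(3)[OF that] unfolding g_def by (blast intro: continuous_on_subset)
  \<comment> \<open>Nonnegative terms cannot cancel, so the regions separate.\<close>
  have "barrier_loss N h Dh (zero_dynamics \<omega>) \<alpha> S \<theta>s = 0
      \<longleftrightarrow> (\<forall>i\<in>{1..N}. (LINT z:S i|lebesgue. g i z) = 0)"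
    unfolding barrier_loss_def g_def[symmetric]
    by (intro sum_nonneg_eq_0_iff)
      (auto simp: g_def set_lebesgue_integral_def intro!: Bochner_Integration.integral_nonneg)
  also have "\<dots> \<longleftrightarrow> (\<forall>i\<in>{1..N}. \<forall>z\<in>S i. g i z = 0)"
    using cont assms(4,5)
    by (intro ball_cong refl set_lebesgue_integral_eq_0_iff_on_solid_region) (auto simp: g_def)
  also have "\<dots> \<longleftrightarrow> (\<forall>i\<in>{1..N}. \<forall>z\<in>S i.
      derivative_along (Dh i \<theta>s) (zero_dynamics \<omega> \<theta>s) z \<ge> - \<alpha> (h i z \<theta>s))"
    by (intro ball_cong refl) (auto simp: g_def max_def)
  finally show ?thesis
    using assms(7) by (simp add: safe_parameters_def)
qed

end
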